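(* Let $g,f\in\mathcal{F}_0$. Then $$\{g,f\}^{-1}=\left\{\frac{1}{g\left(\operatorname{Rev}\left(\frac{x}{f}\right)\right)},\ \frac{x}{\operatorname{Rev}\left(\frac{x}{f}\right)}\right\}.$$
   Context: All power series are formal power series in $x$ with coefficients in $\mathbb{Q}$. $\mathcal{F}_0$ is the set of series $a_0+a_1x+a_2x^2+\cdots$ with $a_0\neq 0$; $\mathcal{F}_1$ is the set of series $a_1x+a_2x^2+\cdots$ with $a_1\ne 0$. $[x^m]$ extracts the coefficient of $x^m$ (and is $0$ for $m<0$). For $v\in\mathcal{F}_1$, $\operatorname{Rev}(v)\in\mathcal{F}_1$ denotes its compositional inverse. The quotient $x/w$ for $w\in\mathcal{F}_1$ is understood as a power series after cancelling the factor $x$. For $g,f\in\mathcal{F}_0$, $\{g,f\}$ denotes the infinite lower-triangular matrix, indexed by $n,k\ge0$, with $(n,k)$ entry $[x^{n-k}]\,g(x)f(x)^n$. The inverse is the matrix inverse. *)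

theory Defs
  imports "HOL-Computational_Algebra.Formal_Power_Series" "HOL-Algebra.Group"
begin

unbundle fps_syntax

text \<open>Infinite matrices over the rationals are functions \<open>nat \<Rightarrow> nat \<Rightarrow> rat\<close>
  (row index first). In the product of lower-triangular matrices, the terms of row \<open>n\<close> with
  index \<open>j > n\<close> vanish, so the sum up to \<open>n\<close> is the full matrix product.\<close>

definition lower_triangular_matrices :: "(nat \<Rightarrow> nat \<Rightarrow> rat) monoid" where
  "lower_triangular_matrices =
    \<lparr> carrier = {A. \<forall>n k. n < k \<longrightarrow> A n k = 0},
      monoid.mult = (\<lambda>A B n k. \<Sum>j\<le>n. A n j * B j k),
      one = (\<lambda>n k. if n = k then 1 else 0) \<rparr>"

text \<open>Hence \<^const>\<open>m_inv\<close> and \<^const>\<open>Units\<close> of this structure are the two-sided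
  matrix inverse and invertibility.\<close>

lemma monoid_lower_triangular_matrices: "monoid lower_triangular_matrices"
proof (rule monoidI)
  fix A B assume "A \<in> carrier lower_triangular_matrices"
    "B \<in> carrier lower_triangular_matrices"
  then show "A \<otimes>\<^bsub>lower_triangular_matrices\<^esub> B \<in> carrier lower_triangular_matrices"
    by (auto simp: lower_triangular_matrices_def intro!: sum.neutral)
next
  show "\<one>\<^bsub>lower_triangular_matrices\<^esub> \<in> carrier lower_triangular_matrices"
    by (simp add: lower_triangular_matrices_def)
next
  fix A B C
  assume "A \<in> carrier lower_triangular_matrices" and B: "B \<in> carrier lower_triangular_matrices"
    and "C \<in> carrier lower_triangular_matrices"
  have "(\<Sum>j\<le>n. (\<Sum>i\<le>n. A n i * B i j) * C j k) =
        (\<Sum>i\<le>n. A n i * (\<Sum>j\<le>i. B i j * C j k))" for n k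
  proof -
    have B': "(\<Sum>j\<le>i. B i j * C j k) = (\<Sum>j\<le>n. B i j * C j k)" if "i \<le> n" for i
      using B that
      by (intro sum.mono_neutral_left) (auto simp: lower_triangular_matrices_def)
    have "(\<Sum>j\<le>n. (\<Sum>i\<le>n. A n i * B i j) * C j k) =
        (\<Sum>i\<le>n. A n i * (\<Sum>j\<le>n. B i j * C j k))"
      unfolding sum_distrib_left sum_distrib_right
      by (subst sum.swap) (simp add: mult.assoc)
    with B' show ?thesis by simp
  qed
  then show "A \<otimes>\<^bsub>lower_triangular_matrices\<^esub> B \<otimes>\<^bsub>lower_triangular_matrices\<^esub> C =
      A \<otimes>\<^bsub>lower_triangular_matrices\<^esub> (B \<otimes>\<^bsub>lower_triangular_matrices\<^esub> C)"
    by (simp add: lower_triangular_matrices_def)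
next
  fix A assume A: "A \<in> carrier lower_triangular_matrices"
  show "\<one>\<^bsub>lower_triangular_matrices\<^esub> \<otimes>\<^bsub>lower_triangular_matrices\<^esub> A = A"
    by (simp add: lower_triangular_matrices_def if_distrib[of "\<lambda>x. x * _"] cong: if_cong)
  have "(\<Sum>j\<le>n. A n j * (if j = k then 1 else 0)) = A n k" for n k
    using A by (simp add: lower_triangular_matrices_def if_distrib[of "\<lambda>x. _ * x"] cong: if_cong)
  then show "A \<otimes>\<^bsub>lower_triangular_matrices\<^esub> \<one>\<^bsub>lower_triangular_matrices\<^esub> = A"
    by (simp add: lower_triangular_matrices_def)
qed

text \<open>The matrix written \<open>{g, f}\<close>. The exponent of \<open>f\<close> is the row index, unlike in a
  Riordan array. The guard is the convention that coefficients of negative degree are zero,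
  since subtraction of naturals truncates.\<close>

definition fps_matrix :: "rat fps \<Rightarrow> rat fps \<Rightarrow> nat \<Rightarrow> nat \<Rightarrow> rat" where
  "fps_matrix g f n k = (if k \<le> n then (g * f ^ n) $ (n - k) else 0)"

text \<open>\<^const>\<open>fps_inv\<close> is the compositional inverse of series with zero constant and nonzero
  linear coefficient, and division of power series cancels common powers of the variable.\<close>

lemma fps_X_divide_nth:
  fixes f :: "rat fps"
  assumes "f $ 0 \<noteq> 0"
  shows "(fps_X / f) $ 0 = 0" "(fps_X / f) $ 1 \<noteq> 0"
  using assms by (simp_all add: fps_divide_unit)

end

(* Let w = x/f and v = Rev(w). For p > 0 the coefficient [x^p] f^(p+1) w' vanishes, because
   f^(p+1) w' = f^p - x (f^p)'/p. By linearity this gives the change of variables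
   [x^n] f^(n+1) w' H(w) = [x^n] H for every power series H, so {1, f} acts on column generating
   functions as composition with v up to a weight. Applied once with v and once with w, it
   evaluates the matrix product; the data (g, f, w) and (1/g(v), x/v, v) play symmetric roles, so
   the same computation gives a two-sided inverse. *)

theory Submission
  imports Defs
begin

text \<open>Since \<open>c ^ i\<close> has no terms below degree \<open>i\<close>, only
  \<open>i\<close> \<le> \<open>n\<close> contributes. This reduces claims about a composite to
  powers of \<open>c\<close>.\<close>

lemma fps_mult_compose_nth:
  fixes a b c :: "'a::comm_ring_1 fps"
  assumes "c $ 0 = 0"
  shows "(a * (b oo c)) $ n = (\<Sum>i\<le>n. b $ i * (a * c ^ i) $ n)"
proof -
  have "(b oo c) $ (n - j) = (\<Sum>i\<le>n. b $ i * (c ^ i) $ (n - j))" for j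
    unfolding fps_compose_nth using assms
    by (intro sum.mono_neutral_left) (auto simp: startsby_zero_power_prefix)
  then have "(a * (b oo c)) $ n = (\<Sum>j\<le>n. a $ j * (\<Sum>i\<le>n. b $ i * (c ^ i) $ (n - j)))"
    by (simp add: fps_mult_nth atMost_atLeast0)
  also have "\<dots> = (\<Sum>i\<le>n. \<Sum>j\<le>n. a $ j * (b $ i * (c ^ i) $ (n - j)))"
    unfolding sum_distrib_left by (rule sum.swap)
  also have "\<dots> = (\<Sum>i\<le>n. b $ i * (a * c ^ i) $ n)"
    by (simp add: fps_mult_nth atMost_atLeast0 sum_distrib_left mult.left_commute)
  finally show ?thesis .
qed

text \<open>As f = x/w, the coefficient is the residue of w'/w^(p+1): for p > 0 this is the
  derivative of -w^(-p)/p and has residue 0, while w'/w has residue 1. The proof avoids Laurent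
  series.\<close>

lemma fps_power_Suc_mult_deriv_nth:
  fixes f w :: "'a::field_char_0 fps"
  assumes fw: "f * w = fps_X" and w0: "w $ 0 = 0"
  shows "(f ^ Suc p * fps_deriv w) $ p = (if p = 0 then 1 else 0)"
proof -
  have "fps_deriv (f * w) = 1"
    using fw by simp
  then have d: "f * fps_deriv w = 1 - fps_deriv f * w"
    by (simp add: algebra_simps)
  show ?thesis
  proof (cases p)
    case 0
    then show ?thesis using w0 by (simp add: d)
  next
    case (Suc q)
    have "f ^ Suc p * fps_deriv w = f ^ p * (1 - fps_deriv f * w)"
      by (simp add: mult.assoc flip: d)
    also have "\<dots> = f ^ p - fps_X * (fps_deriv f * f ^ q)"
      by (simp add: Suc algebra_simps flip: fw)
    finally have e: "(f ^ Suc p * fps_deriv w) $ p = f ^ p $ p - (fps_deriv f * f ^ q) $ q"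
      by (simp add: Suc)
    have "fps_deriv (f ^ p) = of_nat p * (fps_deriv f * f ^ q)"
      by (simp only: Suc fps_deriv_power diff_Suc_1 mult.assoc fps_of_nat)
    \<comment> \<open>Differentiation multiplies the coefficient of x^p by p = q + 1, a factor that
      characteristic 0 allows to be cancelled.\<close>
    then have "of_nat p * f ^ p $ p = of_nat p * (fps_deriv f * f ^ q) $ q"
      by (metis Suc Suc_eq_plus1 fps_deriv_nth fps_mult_of_nat_nth(1))
    then have "f ^ p $ p = (fps_deriv f * f ^ q) $ q"
      using Suc by (simp del: of_nat_Suc power_Suc)
    with e Suc show ?thesis
      by (simp del: power_Suc)
  qed
qed

text \<open>For h = x^i with i \<le> n, i of the factors f turn w^i into x^i, which leaves the
  previous lemma with p = n - i.\<close>

lemma fps_change_of_variable_nth: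
  fixes f w h :: "'a::field_char_0 fps"
  assumes fw: "f * w = fps_X" and w0: "w $ 0 = 0"
  shows "(f ^ Suc n * fps_deriv w * (h oo w)) $ n = h $ n"
proof -
  have "(f ^ Suc n * fps_deriv w * w ^ i) $ n = (if n = i then 1 else 0)" if "i \<le> n" for i
  proof -
    have "f ^ Suc n = f ^ Suc (n - i) * f ^ i"
      using that by (simp flip: power_add)
    then have "f ^ Suc n * fps_deriv w * w ^ i =
        fps_X ^ i * (f ^ Suc (n - i) * fps_deriv w)"
      by (simp only: power_mult_distrib mult_ac flip: fw)
    also have "\<dots> $ n = (if n = i then 1 else 0)"
      using that fps_power_Suc_mult_deriv_nth[OF fw w0, of "n - i"]
      by (auto simp: fps_X_power_mult_nth simp del: power_Suc)
    finally show ?thesis .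
  qed
  then have "(\<Sum>i\<le>n. h $ i * (f ^ Suc n * fps_deriv w * w ^ i) $ n) =
      (\<Sum>i\<le>n. if n = i then h $ i else 0)"
    by (intro sum.cong) auto
  then show ?thesis
    by (simp add: fps_mult_compose_nth[OF w0])
qed

lemma fps_deriv_compose_inverse:
  fixes v w :: "'a::idom fps"
  assumes "v $ 0 = 0" and "w oo v = fps_X"
  shows "(fps_deriv w oo v) * fps_deriv v = 1"
  using fps_compose_deriv[OF assms(1), of w] assms(2) by simp

text \<open>Substituting v into f w = x gives f(v) x = v; multiplying by u turns v into x, and x
  cancels.\<close>

lemma fps_cofactor_compose_inverse:
  fixes f u v w :: "'a::idom fps"
  assumes "f * w = fps_X" and "u * v = fps_X" and "v $ 0 = 0" and "w oo v = fps_X"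
  shows "(f oo v) * u = 1"
proof -
  have "(f oo v) * fps_X = v"
    using fps_compose_mult_distrib[OF assms(3), of f w] assms by simp
  then have "u * ((f oo v) * fps_X) = fps_X"
    using assms(2) by simp
  then have "((f oo v) * u) * fps_X = 1 * fps_X"
    by (simp add: mult_ac)
  then show ?thesis
    by (simp only: mult_right_cancel[OF fps_X_neq_zero])
qed

text \<open>Product equations replace quotients and \<open>fps_inv\<close>, so that exchanging (g,
  f, w) with (h, u, v) gives the product in the other order.\<close>

lemma fps_matrix_mult_inverse:
  assumes fw: "f * w = fps_X" and w0: "w $ 0 = 0"
    and uv: "u * v = fps_X" and v0: "v $ 0 = 0"
    and wv: "w oo v = fps_X" and gh: "g * (h oo w) = 1"
  shows "fps_matrix g f \<otimes>\<^bsub>lower_triangular_matrices\<^esub> fps_matrix h u =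
    \<one>\<^bsub>lower_triangular_matrices\<^esub>"
proof -
  have "(\<Sum>j\<le>n. fps_matrix g f n j * fps_matrix h u j k) = (if n = k then 1 else 0)" for n k
  proof -
    \<comment> \<open>This is the generating function of column k of {h, u}. It solves u v' c(v) =
      x^k h: substituting w turns 1/u into f and 1/v' into w'.\<close>
    define c where "c = w ^ k * fps_deriv w * f * (h oo w)"
    have hwv: "(h oo w) oo v = h"
      using fps_compose_assoc[OF v0 w0, of h] wv by simp
    have "u * fps_deriv v * (c oo v) =
        fps_X ^ k * h * ((fps_deriv w oo v) * fps_deriv v) * ((f oo v) * u)"
      by (simp add: c_def fps_compose_mult_distrib[OF v0] fps_compose_power[OF v0, symmetric] wv hwv mult_ac)
    also have "\<dots> = fps_X ^ k * h"
      by (simp add: fps_deriv_compose_inverse[OF v0 wv] fps_cofactor_compose_inverse[OF fw uv v0 wv])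
    finally have "u ^ Suc j * fps_deriv v * (c oo v) = fps_X ^ k * (h * u ^ j)" for j
      by (simp add: mult_ac)
    then have c: "fps_matrix h u j k = c $ j" for j
      using fps_change_of_variable_nth[OF uv v0, of j c]
      by (auto simp: fps_matrix_def fps_X_power_mult_nth simp del: power_Suc split: if_splits)
    \<comment> \<open>Row n uses the single series g f^n, so row times column is a Cauchy
      product.\<close>
    have "(\<Sum>j\<le>n. fps_matrix g f n j * fps_matrix h u j k) = (c * (g * f ^ n)) $ n"
      unfolding c by (simp add: fps_matrix_def fps_mult_nth[of c] atMost_atLeast0 mult.commute)
    also have "c * (g * f ^ n) = f ^ Suc n * fps_deriv w * (fps_X ^ k oo w) * (g * (h oo w))"
      by (simp add: c_def fps_compose_power[OF w0, symmetric] fps_X_fps_compose_startby0[OF w0] mult_ac)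
    also have "\<dots> $ n = (if n = k then 1 else 0)"
      using fps_change_of_variable_nth[OF fw w0, of n "fps_X ^ k"] by (simp add: gh)
    finally show ?thesis .
  qed
  then show ?thesis
    by (simp add: lower_triangular_matrices_def)
qed

lemma fps_matrix_in_carrier: "fps_matrix g f \<in> carrier lower_triangular_matrices"
  by (simp add: lower_triangular_matrices_def fps_matrix_def)

theorem corollary20:
  fixes g f :: "rat fps"
  assumes "g $ 0 \<noteq> 0" and "f $ 0 \<noteq> 0"
  shows "fps_matrix g f \<in> Units lower_triangular_matrices \<and>
    inv\<^bsub>lower_triangular_matrices\<^esub> (fps_matrix g f) =
      fps_matrix (1 / (g oo fps_inv (fps_X / f))) (fps_X / fps_inv (fps_X / f))"
proof -
  interpret monoid lower_triangular_matrices
    by (rule monoid_lower_triangular_matrices)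
  define w where "w = fps_X / f"
  define v where "v = fps_inv w"
  define u where "u = fps_X / v"
  define h where "h = 1 / (g oo v)"
  have w0: "w $ 0 = 0" and w1: "w $ 1 \<noteq> 0"
    using fps_X_divide_nth[OF assms(2)] by (simp_all add: w_def)
  have fw: "f * w = fps_X"
    using assms(2) by (simp add: w_def fps_divide_unit inverse_mult_eq_1' mult.left_commute)
  have v0: "v $ 0 = 0"
    by (simp add: v_def fps_inv_def)
  have wv: "w oo v = fps_X" and vw: "v oo w = fps_X"
    using w0 w1 by (simp_all add: v_def fps_inv fps_inv_right)
  have "v \<noteq> 0"
    using vw by auto
  \<comment> \<open>The quotient x/v must be exact: v is x times the unit f(v).\<close>
  moreover have "v dvd fps_X"
  proof -
    have "(f oo v) * fps_X = v"
      using fps_compose_mult_distrib[OF v0, of f w]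
      by (simp add: fw wv fps_X_fps_compose_startby0[OF v0])
    moreover have "(f oo v) dvd 1"
      using assms(2) by simp
    ultimately show ?thesis
      by (metis dvd_refl mult_unit_dvd_iff')
  qed
  ultimately have uv: "u * v = fps_X"
    by (simp add: u_def)
  have hg: "h * (g oo v) = 1"
    using assms(1) by (simp add: h_def fps_divide_unit inverse_mult_eq_1)
  \<comment> \<open>Substituting w moves the composition from g to h, as the first of the two
    products requires.\<close>
  have "(h * (g oo v)) oo w = 1"
    by (simp add: hg)
  then have gh: "g * (h oo w) = 1"
    using fps_compose_assoc[OF w0 v0, of g]
    by (simp add: fps_compose_mult_distrib[OF w0] vw mult.commute)
  have "fps_matrix g f \<otimes>\<^bsub>lower_triangular_matrices\<^esub> fps_matrix h u =
      \<one>\<^bsub>lower_triangular_matrices\<^esub>"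
    by (rule fps_matrix_mult_inverse) (fact fw w0 uv v0 wv gh)+
  moreover have "fps_matrix h u \<otimes>\<^bsub>lower_triangular_matrices\<^esub> fps_matrix g f =
      \<one>\<^bsub>lower_triangular_matrices\<^esub>"
    by (rule fps_matrix_mult_inverse) (fact fw w0 uv v0 vw hg)+
  ultimately have "fps_matrix g f \<in> Units lower_triangular_matrices"
    and "inv\<^bsub>lower_triangular_matrices\<^esub> (fps_matrix g f) = fps_matrix h u"
    using fps_matrix_in_carrier
    by (auto simp: Units_def intro!: inv_unique'[symmetric])
  then show ?thesis
    by (simp add: h_def u_def v_def w_def)
qed

end
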